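(* Let $G$ be a group and let $X$ and $Y$ be normal subsets of $G$. Suppose that $X$ is a group (i.e. a subgroup of $G$). Set $N:=\langle Y\rangle$ and $Z:=X\cap N$, and for each $n\in N$ set $Y_n:=(n^{-1}Y)\cap Z$. Then the following two conditions are equivalent: (1) $G=X\times Y$. (2) $G=X\circ_Z N$ and $|Y_n|=1$ for all $n\in N$. Furthermore, if either of (1) or (2) holds, then $Y$ is a normal transversal of $Z$ in $N$ and $Z$ acts semi-regularly on $\Omega_N$; if, moreover, $N$ is finite then $k(N)=k(Z)k(N/Z)$.
   Context: Groups may be infinite unless stated otherwise. A subset of a group $G$ is normal if it is invariant under conjugation by all elements of $G$. Set-direct product: for a group $G$ and non-empty subsets $X,Y\subseteq G$, the setwise product $XY$ is called direct, and is then written $X\times Y$, if both $X$ and $Y$ are normal in $G$ and every $g\in XY$ has a unique representation $g=xy$ with $x\in X$, $y\in Y$. Central product: $G=M\circ_Z N$ means that $M,N$ are subgroups of $G$ with $G=MN$, $M$ and $N$ centralize each other, and $Z=M\cap N$ (then $M,N$ are normal and $Z$ is central in $G$). $\Omega_N$ is the set of all conjugacy classes of $G$ contained in $N$, on which the central subgroup $Z\le N$ acts by multiplication, $(z,C)\mapsto zC$. The action is semi-regular if all stabilizers are trivial. A normal transversal of $Z$ in $N$ is a transversal (a set containing exactly one element of each coset of $Z$ in $N$) that is a normal subset. $k(H)$ is the number of conjugacy classes of a finite group $H$. *)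

theory Defs
  imports "HOL-Algebra.Group_Action" "HOL-Algebra.Generated_Groups"
begin

definition normal_subset :: "('a, 'b) monoid_scheme \<Rightarrow> 'a set \<Rightarrow> bool" where
  "normal_subset G S \<longleftrightarrow> S \<subseteq> carrier G \<and>
     (\<forall>g\<in>carrier G. \<forall>s\<in>S. g \<otimes>\<^bsub>G\<^esub> s \<otimes>\<^bsub>G\<^esub> inv\<^bsub>G\<^esub> g \<in> S)"

text \<open>The setwise product of the non-empty subsets \<open>X\<close> and \<open>Y\<close> is direct.
  The equation \<open>G = X \<times> Y\<close> is this together with \<open>carrier G = X <#>\<^bsub>G\<^esub> Y\<close>.\<close>
definition set_direct :: "('a, 'b) monoid_scheme \<Rightarrow> 'a set \<Rightarrow> 'a set \<Rightarrow> bool" where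
  "set_direct G X Y \<longleftrightarrow> X \<noteq> {} \<and> Y \<noteq> {} \<and> normal_subset G X \<and> normal_subset G Y \<and>
     (\<forall>g\<in>X <#>\<^bsub>G\<^esub> Y. \<exists>!p. p \<in> X \<times> Y \<and> g = fst p \<otimes>\<^bsub>G\<^esub> snd p)"

definition is_set_direct_product :: "('a, 'b) monoid_scheme \<Rightarrow> 'a set \<Rightarrow> 'a set \<Rightarrow> bool" where
  "is_set_direct_product G X Y \<longleftrightarrow> set_direct G X Y \<and> carrier G = X <#>\<^bsub>G\<^esub> Y"

definition is_central_product ::
    "('a, 'b) monoid_scheme \<Rightarrow> 'a set \<Rightarrow> 'a set \<Rightarrow> 'a set \<Rightarrow> bool" where
  "is_central_product G M Z N \<longleftrightarrow> subgroup M G \<and> subgroup N G \<and> carrier G = M <#>\<^bsub>G\<^esub> N \<and>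
     (\<forall>m\<in>M. \<forall>n\<in>N. m \<otimes>\<^bsub>G\<^esub> n = n \<otimes>\<^bsub>G\<^esub> m) \<and> Z = M \<inter> N"

definition conj_classes :: "('a, 'b) monoid_scheme \<Rightarrow> 'a set set" where
  "conj_classes G =
     orbits G (carrier G) (\<lambda>g. \<lambda>h\<in>carrier G. g \<otimes>\<^bsub>G\<^esub> h \<otimes>\<^bsub>G\<^esub> inv\<^bsub>G\<^esub> g)"

text \<open>Meaningful only for groups with finitely many classes, in particular finite groups.\<close>
definition num_conj_classes :: "('a, 'b) monoid_scheme \<Rightarrow> nat" where
  "num_conj_classes G = card (conj_classes G)"

text \<open>These are classes under conjugation by the whole group \<open>G\<close>, not by \<open>N\<close>.\<close>
definition conj_classes_in :: "('a, 'b) monoid_scheme \<Rightarrow> 'a set \<Rightarrow> 'a set set" where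
  "conj_classes_in G N = {C \<in> conj_classes G. C \<subseteq> N}"

definition semiregular_action ::
    "('a, 'b) monoid_scheme \<Rightarrow> 'c set \<Rightarrow> ('a \<Rightarrow> 'c \<Rightarrow> 'c) \<Rightarrow> bool" where
  "semiregular_action H E \<phi> \<longleftrightarrow> group_action H E \<phi> \<and> (\<forall>x\<in>E. stabilizer H \<phi> x = {\<one>\<^bsub>H\<^esub>})"

text \<open>Right cosets are used; below \<open>Z\<close> is central, so they agree with the left cosets.
  Normality of the transversal refers to conjugation by all of \<open>G\<close>.\<close>
definition normal_transversal ::
    "('a, 'b) monoid_scheme \<Rightarrow> 'a set \<Rightarrow> 'a set \<Rightarrow> 'a set \<Rightarrow> bool" where
  "normal_transversal G T Z N \<longleftrightarrow> T \<subseteq> N \<and> normal_subset G T \<and>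
     (\<forall>C\<in>rcosets\<^bsub>G\<lparr>carrier := N\<rparr>\<^esub> Z. \<exists>!t. t \<in> T \<inter> C)"

end

theory Submission
  imports Defs
begin

text \<open>
  If \<open>G = X \<times> Y\<close> with \<open>X\<close> a subgroup, uniqueness of factorizations forces \<open>X\<close> and \<open>Y\<close> to commute,
  so \<open>X\<close> centralizes \<open>N\<close>. If \<open>n = x y\<close>, then \<open>x = n y\<^sup>-\<^sup>1\<close> lies in \<open>Z\<close>: hence \<open>N = Z \<times> Y\<close> and
  \<open>Y\<^sub>n = {x\<^sup>-\<^sup>1}\<close>. Conversely, writing \<open>g = x n\<close> and \<open>Y\<^sub>n = {z}\<close> gives the factorization
  \<open>g = (x z\<^sup>-\<^sup>1)(n z)\<close>, and \<open>x y = x' y'\<close> puts both \<open>1\<close> and \<open>x'\<^sup>-\<^sup>1 x\<close> into \<open>Y\<^sub>y\<close>.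
  The remaining claims follow from \<open>N = Z \<times> Y\<close>. The class formula holds for every direct product
  \<open>X \<times> Y\<close> with \<open>X\<close> a subgroup: conjugating \<open>x y\<close> by \<open>a b\<close> conjugates \<open>x\<close> by \<open>a\<close> and \<open>y\<close> by \<open>b\<close>,
  so a class amounts to a class of \<open>X\<close> together with a class of the quotient by \<open>X\<close>.
\<close>

section \<open>Conjugacy classes and set-direct products in terms of elements\<close>

lemma conj_classes_eq:
  "conj_classes G = (\<lambda>h. (\<lambda>g. g \<otimes>\<^bsub>G\<^esub> h \<otimes>\<^bsub>G\<^esub> inv\<^bsub>G\<^esub> g) ` carrier G) ` carrier G"
  unfolding conj_classes_def orbits_def orbit_def by (auto simp: image_def)

context group
begin

text \<open>Unique existence of a pair splits into existence and a cancellation rule on factors, the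
  form used throughout. Non-emptiness of \<open>X\<close> and \<open>Y\<close> is absorbed:
  factoring \<open>\<one>\<close> produces an element of each.\<close>

lemma is_set_direct_product_iff:
  "is_set_direct_product G X Y \<longleftrightarrow> normal_subset G X \<and> normal_subset G Y \<and>
     (\<forall>g\<in>carrier G. \<exists>x\<in>X. \<exists>y\<in>Y. g = x \<otimes> y) \<and>
     (\<forall>x\<in>X. \<forall>x'\<in>X. \<forall>y\<in>Y. \<forall>y'\<in>Y. x \<otimes> y = x' \<otimes> y' \<longrightarrow> x = x' \<and> y = y')"
  (is "?L \<longleftrightarrow> ?R")
proof
  assume L: ?L
  have "x = x' \<and> y = y'" if "x \<in> X" "x' \<in> X" "y \<in> Y" "y' \<in> Y" "x \<otimes> y = x' \<otimes> y'" for x x' y y'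
  proof -
    have "x \<otimes> y \<in> X <#> Y"
      using that by (auto simp: set_mult_def)
    then have "\<exists>!p. p \<in> X \<times> Y \<and> x \<otimes> y = fst p \<otimes> snd p"
      using L by (simp add: is_set_direct_product_def set_direct_def)
    then have "(x, y) = (x', y')"
      by (rule ex1E) (metis SigmaI fst_conv snd_conv that)
    then show ?thesis by simp
  qed
  moreover have "\<forall>g\<in>carrier G. \<exists>x\<in>X. \<exists>y\<in>Y. g = x \<otimes> y"
    using L by (auto simp: is_set_direct_product_def set_mult_def)
  ultimately show ?R
    using L unfolding is_set_direct_product_def set_direct_def by blast
next
  assume R: ?R
  then have "X \<noteq> {}" "Y \<noteq> {}"
    using one_closed by blast+
  moreover have "carrier G = X <#> Y"
  proof
    show "carrier G \<subseteq> X <#> Y"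
      using R by (fastforce simp: set_mult_def)
    show "X <#> Y \<subseteq> carrier G"
      using R by (auto simp: set_mult_def normal_subset_def)
  qed
  moreover have "\<exists>!p. p \<in> X \<times> Y \<and> g = fst p \<otimes> snd p" if g: "g \<in> X <#> Y" for g
  proof -
    obtain x y where xy: "x \<in> X" "y \<in> Y" "g = x \<otimes> y"
      using g by (auto simp: set_mult_def)
    show ?thesis
    proof (rule ex1I[of _ "(x, y)"])
      show "(x, y) \<in> X \<times> Y \<and> g = fst (x, y) \<otimes> snd (x, y)"
        using xy by simp
      show "p = (x, y)" if "p \<in> X \<times> Y \<and> g = fst p \<otimes> snd p" for p
        using that xy R by (metis mem_Times_iff prod.collapse)
    qed
  qed
  ultimately show ?L
    using R unfolding is_set_direct_product_def set_direct_def by blast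
qed

lemma is_set_direct_product_subgroup_iff:
  assumes "subgroup N G"
  shows "is_set_direct_product (G\<lparr>carrier := N\<rparr>) X Y \<longleftrightarrow>
     normal_subset (G\<lparr>carrier := N\<rparr>) X \<and> normal_subset (G\<lparr>carrier := N\<rparr>) Y \<and>
     (\<forall>n\<in>N. \<exists>x\<in>X. \<exists>y\<in>Y. n = x \<otimes> y) \<and>
     (\<forall>x\<in>X. \<forall>x'\<in>X. \<forall>y\<in>Y. \<forall>y'\<in>Y. x \<otimes> y = x' \<otimes> y' \<longrightarrow> x = x' \<and> y = y')"
  using group.is_set_direct_product_iff[OF subgroup_imp_group[OF assms], of X Y] by simp

section \<open>Commutation and componentwise conjugation\<close>

lemma conj_eq_self_iff:
  "\<lbrakk>g \<in> carrier G; h \<in> carrier G\<rbrakk> \<Longrightarrow> g \<otimes> h \<otimes> inv g = h \<longleftrightarrow> g \<otimes> h = h \<otimes> g"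
  using inv_solve_right[of "h" "g \<otimes> h" g] by auto

text \<open>The centralizer of \<open>x\<close> is a subgroup, so with \<open>S\<close> it contains
  everything that \<open>S\<close> generates.\<close>

lemma commute_generate:
  assumes S: "S \<subseteq> carrier G" and x: "x \<in> carrier G"
    and comm: "\<And>s. s \<in> S \<Longrightarrow> x \<otimes> s = s \<otimes> x" and n: "n \<in> generate G S"
  shows "x \<otimes> n = n \<otimes> x"
  using n
proof (induction rule: generate.induct)
  case one
  show ?case using x by simp
next
  case (incl h)
  then show ?case by (rule comm)
next
  case (inv h)
  have h: "h \<in> carrier G" using inv S by auto
  \<comment> \<open>Insert \<open>inv h \<otimes> h\<close> in front; once \<open>h\<close> and
    \<open>x\<close> are swapped, \<open>h\<close> cancels against the last factor.\<close>
  have "x \<otimes> inv h = inv h \<otimes> (h \<otimes> x) \<otimes> inv h"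
    using h x by (simp add: inv_solve_left m_assoc)
  also have "\<dots> = inv h \<otimes> x"
    using comm[OF inv] h x by (simp flip: comm[OF inv] add: m_assoc)
  finally show ?case .
next
  case (eng h1 h2)
  then have "h1 \<in> carrier G" "h2 \<in> carrier G"
    using generate_in_carrier[OF S] by auto
  with eng.IH x show ?case by (metis m_assoc)
qed

lemma set_direct_commute:
  assumes D: "is_set_direct_product G X Y" and X: "subgroup X G" and x: "x \<in> X" and y: "y \<in> Y"
  shows "x \<otimes> y = y \<otimes> x"
proof -
  note d = D[unfolded is_set_direct_product_iff]
  have c: "x \<in> carrier G" "y \<in> carrier G"
    using x y d by (auto simp: normal_subset_def)
  \<comment> \<open>\<open>x y x\<^sup>-\<^sup>1 \<in> Y\<close> is also \<open>[x, y] y\<close> with \<open>[x, y] \<in> X\<close>, so uniqueness identifies the \<open>Y\<close>-parts.\<close>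
  have "x \<otimes> y \<otimes> inv x \<in> Y"
    using d c y by (auto simp: normal_subset_def)
  moreover have "x \<otimes> (y \<otimes> inv x \<otimes> inv y) \<in> X"
  proof -
    have "y \<otimes> inv x \<otimes> inv y \<in> X"
      using d c subgroup.m_inv_closed[OF X x] by (auto simp: normal_subset_def)
    then show ?thesis using subgroup.m_closed[OF X x] by blast
  qed
  moreover have "\<one> \<otimes> (x \<otimes> y \<otimes> inv x) = x \<otimes> (y \<otimes> inv x \<otimes> inv y) \<otimes> y"
    using c by (simp add: m_assoc)
  ultimately have "x \<otimes> y \<otimes> inv x = y"
    using d y subgroup.one_closed[OF X] by blast
  then show ?thesis using conj_eq_self_iff[of x y] c by simp
qed

text \<open>The commutation hypotheses are those that hold between \<open>X\<close> and
  \<open>Y\<close> in a direct product, for \<open>a\<close>, \<open>x\<close> in \<open>X\<close>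
  and \<open>b\<close>, \<open>y\<close> in \<open>Y\<close>.\<close>

lemma commute_conj_mult:
  assumes "a \<in> carrier G" "b \<in> carrier G" "x \<in> carrier G" "y \<in> carrier G"
    and "a \<otimes> b = b \<otimes> a" "a \<otimes> y = y \<otimes> a" "x \<otimes> b = b \<otimes> x"
  shows "(a \<otimes> b) \<otimes> (x \<otimes> y) \<otimes> inv (a \<otimes> b) = (a \<otimes> x \<otimes> inv a) \<otimes> (b \<otimes> y \<otimes> inv b)"
proof -
  \<comment> \<open>In the right-hand product \<open>inv a\<close> has to travel past
    \<open>b\<close> and then past \<open>y\<close>.\<close>
  have ya: "inv a \<otimes> y = y \<otimes> inv a" and ba: "inv a \<otimes> b = b \<otimes> inv a"
    using assms by (metis inv_closed inv_solve_left inv_solve_right m_assoc m_closed)+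
  \<comment> \<open>The factors keep their order because \<open>a\<close> and \<open>b\<close>
    commute.\<close>
  have ib: "inv (a \<otimes> b) = inv a \<otimes> inv b"
    using assms by (simp add: inv_mult_group)
  have "(a \<otimes> x \<otimes> inv a) \<otimes> (b \<otimes> y \<otimes> inv b) = a \<otimes> (x \<otimes> ((inv a \<otimes> b) \<otimes> (y \<otimes> inv b)))"
    using assms by (simp add: m_assoc)
  also have "\<dots> = a \<otimes> ((x \<otimes> b) \<otimes> ((inv a \<otimes> y) \<otimes> inv b))"
    unfolding ba using assms(1-4) by (simp add: m_assoc)
  also have "\<dots> = (a \<otimes> b) \<otimes> (x \<otimes> y) \<otimes> (inv a \<otimes> inv b)"
    unfolding ya assms(7) using assms(1-4) by (simp add: m_assoc)
  finally show ?thesis unfolding ib by simp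
qed

section \<open>Counting conjugacy classes of a direct product\<close>

lemma conj_FactGroup:
  assumes "N \<lhd> G" "g \<in> carrier G" "h \<in> carrier G"
  shows "(N #> g) \<otimes>\<^bsub>G Mod N\<^esub> (N #> h) \<otimes>\<^bsub>G Mod N\<^esub> inv\<^bsub>G Mod N\<^esub> (N #> g) = N #> (g \<otimes> h \<otimes> inv g)"
proof -
  interpret normal N G by fact
  have "N #> g \<in> carrier (G Mod N)"
    using assms by (auto simp: carrier_FactGroup)
  then show ?thesis
    using assms by (simp add: inv_FactGroup rcos_inv rcos_sum)
qed

text \<open>Both indices run over \<open>G\<close> instead of over cosets, so classes of the
  quotient appear directly as images of classes of \<open>G\<close> under
  \<open>(#>) N\<close>.\<close>

lemma conj_classes_FactGroup:
  assumes "N \<lhd> G"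
  shows "conj_classes (G Mod N) =
    (\<lambda>h. (\<lambda>g. N #> (g \<otimes> h \<otimes> inv g)) ` carrier G) ` carrier G"
proof -
  have "(\<lambda>g. g \<otimes>\<^bsub>G Mod N\<^esub> (N #> h) \<otimes>\<^bsub>G Mod N\<^esub> inv\<^bsub>G Mod N\<^esub> g) ` carrier (G Mod N)
     = (\<lambda>g. N #> (g \<otimes> h \<otimes> inv g)) ` carrier G" if "h \<in> carrier G" for h
    unfolding carrier_FactGroup image_image
    by (rule image_cong[OF refl]) (rule conj_FactGroup[OF assms _ that])
  then show ?thesis
    unfolding conj_classes_eq by (simp add: carrier_FactGroup image_image)
qed

text \<open>The bijection sends a class to its projection to \<open>X\<close> paired with its image
  in \<open>G Mod X\<close>.\<close>

lemma set_direct_num_conj_classes: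
  assumes D: "is_set_direct_product G X Y" and X: "subgroup X G"
  shows "num_conj_classes G = num_conj_classes (G\<lparr>carrier := X\<rparr>) * num_conj_classes (G Mod X)"
proof -
  note d = D[unfolded is_set_direct_product_iff]
  have cX: "x \<in> carrier G" if "x \<in> X" for x
    using that d by (auto simp: normal_subset_def)
  have cY: "y \<in> carrier G" if "y \<in> Y" for y
    using that d by (auto simp: normal_subset_def)
  have conjX: "g \<otimes> x \<otimes> inv g \<in> X" if "g \<in> carrier G" "x \<in> X" for g x
    using that d by (auto simp: normal_subset_def)
  have conjY: "g \<otimes> y \<otimes> inv g \<in> Y" if "g \<in> carrier G" "y \<in> Y" for g y
    using that d by (auto simp: normal_subset_def)
  have nX: "X \<lhd> G"
    using X conjX by (simp add: normal_inv_iff)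
  have comm: "x \<otimes> y = y \<otimes> x" if "x \<in> X" "y \<in> Y" for x y
    using set_direct_commute[OF D X that] .
  \<comment> \<open>The projection to the \<open>X\<close>-factor, well defined on the carrier by
    uniqueness of factorizations.\<close>
  define p where "p g = (THE x. x \<in> X \<and> (\<exists>y\<in>Y. g = x \<otimes> y))" for g
  have p: "p (x \<otimes> y) = x" if "x \<in> X" "y \<in> Y" for x y
    unfolding p_def by (rule the_equality) (use that d in blast)+
  have ex: "\<exists>x\<in>X. \<exists>y\<in>Y. g = x \<otimes> y" if "g \<in> carrier G" for g
    using that d by blast
  have coset: "X #> (x \<otimes> y) = X #> y" if "x \<in> X" "y \<in> Y" for x y
    using that cX cY X by (metis coset_join2 coset_mult_assoc subgroup.subset)
  \<comment> \<open>\<open>Y\<close> meets each coset of \<open>X\<close> at most once, so an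
    element of \<open>Y\<close> can be recovered from its coset.\<close>
  have coset_inj: "y = y'" if "y \<in> Y" "y' \<in> Y" "X #> y = X #> y'" for y y'
  proof -
    have "y \<in> X #> y'"
      using that rcos_self[OF cY X] by blast
    then obtain x where "x \<in> X" "y = x \<otimes> y'"
      by (auto simp: r_coset_def)
    then have "\<one> \<otimes> y = x \<otimes> y'" using that cY by simp
    then show ?thesis using d that \<open>x \<in> X\<close> subgroup.one_closed[OF X] by blast
  qed
  \<comment> \<open>The classes of \<open>G\<close>, \<open>X\<close> and \<open>G Mod X\<close> as
    functions of a representative in \<open>G\<close>.\<close>
  define cl where "cl h = (\<lambda>g. g \<otimes> h \<otimes> inv g) ` carrier G" for h
  define clX where "clX x = (\<lambda>g. g \<otimes> x \<otimes> inv g) ` X" for x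
  define clQ where "clQ h = (\<lambda>g. X #> (g \<otimes> h \<otimes> inv g)) ` carrier G" for h
  have conj: "\<And>a b x y. \<lbrakk>a \<in> X; b \<in> Y; x \<in> X; y \<in> Y\<rbrakk> \<Longrightarrow>
      (a \<otimes> b) \<otimes> (x \<otimes> y) \<otimes> inv (a \<otimes> b) = (a \<otimes> x \<otimes> inv a) \<otimes> (b \<otimes> y \<otimes> inv b)"
    by (rule commute_conj_mult) (use cX cY comm in auto)
  have CX: "conj_classes (G\<lparr>carrier := X\<rparr>) = clX ` X"
    unfolding conj_classes_eq clX_def using X by (auto intro!: image_cong simp: m_inv_consistent)
  have CG: "conj_classes G = cl ` carrier G"
    unfolding conj_classes_eq cl_def ..
  have CQ: "conj_classes (G Mod X) = clQ ` carrier G"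
    unfolding conj_classes_FactGroup[OF nX] clQ_def ..
  \<comment> \<open>As \<open>g\<close> runs over \<open>G\<close>, its factors \<open>a\<close> and
    \<open>b\<close> run independently over \<open>X\<close> and \<open>Y\<close>, and each
    conjugates only its own component.\<close>
  have cl_split: "cl (x \<otimes> y) = (\<lambda>(a, b). (a \<otimes> x \<otimes> inv a) \<otimes> (b \<otimes> y \<otimes> inv b)) ` (X \<times> Y)"
    if "x \<in> X" "y \<in> Y" for x y
  proof -
    have "carrier G = (\<lambda>(a, b). a \<otimes> b) ` (X \<times> Y)"
      using ex cX cY by (fastforce simp: image_iff)
    then show ?thesis
      unfolding cl_def using conj that by (auto simp: image_image intro!: image_cong)
  qed
  have Y0: "Y \<noteq> {}" using ex one_closed by blast
  have p_cl: "p ` cl (x \<otimes> y) = clX x" if "x \<in> X" "y \<in> Y" for x y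
  proof -
    have "p ` cl (x \<otimes> y) = (\<lambda>(a, b). a \<otimes> x \<otimes> inv a) ` (X \<times> Y)"
      unfolding cl_split[OF that] image_image
      by (rule image_cong) (use p conjX conjY cX cY that in auto)
    also have "\<dots> = clX x"
      unfolding clX_def using Y0 by force
    finally show ?thesis .
  qed
  have q_cl: "(#>) X ` cl g = clQ g" for g
    unfolding cl_def clQ_def image_image ..
  \<comment> \<open>Passing to cosets erases the \<open>X\<close>-component, so the class in the
    quotient depends on \<open>y\<close> alone.\<close>
  have clQ_Y: "clQ (x \<otimes> y) = (\<lambda>b. X #> (b \<otimes> y \<otimes> inv b)) ` Y" if "x \<in> X" "y \<in> Y" for x y
  proof -
    have "clQ (x \<otimes> y) = (\<lambda>(a, b). X #> (b \<otimes> y \<otimes> inv b)) ` (X \<times> Y)"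
      unfolding q_cl[symmetric] cl_split[OF that] image_image
      by (rule image_cong) (use coset conjX conjY cX cY that in auto)
    also have "\<dots> = (\<lambda>b. X #> (b \<otimes> y \<otimes> inv b)) ` Y"
      using subgroup.one_closed[OF X] by force
    finally show ?thesis .
  qed
  have cl_cong: "cl (x \<otimes> y) = cl (x' \<otimes> y')"
    if xy: "x \<in> X" "y \<in> Y" "x' \<in> X" "y' \<in> Y"
      and eX: "clX x = clX x'" and eQ: "clQ (x \<otimes> y) = clQ (x' \<otimes> y')" for x y x' y'
  proof -
    have img: "b \<otimes> u \<otimes> inv b \<in> Y" if "b \<in> Y" "u \<in> Y" for b u
      using that conjY cY by blast
    \<comment> \<open>Equal classes in the quotient have equal coset images; injectivity of
      \<open>(#>) X\<close> on \<open>Y\<close> lifts this to the sets of conjugates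
      themselves.\<close>
    have "(#>) X ` ((\<lambda>b. b \<otimes> y \<otimes> inv b) ` Y) = (#>) X ` ((\<lambda>b. b \<otimes> y' \<otimes> inv b) ` Y)"
      using eQ xy by (simp add: clQ_Y image_image)
    moreover have "inj_on ((#>) X) Y"
      using coset_inj by (auto intro: inj_onI)
    ultimately have eY: "(\<lambda>b. b \<otimes> y \<otimes> inv b) ` Y = (\<lambda>b. b \<otimes> y' \<otimes> inv b) ` Y"
      using img xy by (subst (asm) inj_on_image_eq_iff) auto
    \<comment> \<open>The class is the setwise product of its two component orbits, hence determined
      by them.\<close>
    have "cl (u \<otimes> v) = (\<lambda>(a, b). a \<otimes> b) ` (clX u \<times> (\<lambda>b. b \<otimes> v \<otimes> inv b) ` Y)"
      if "u \<in> X" "v \<in> Y" for u v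
      unfolding cl_split[OF that] clX_def by force
    with eX eY xy show ?thesis by simp
  qed
  have CG_ex: "\<exists>x\<in>X. \<exists>y\<in>Y. C = cl (x \<otimes> y)" if "C \<in> conj_classes G" for C
  proof -
    obtain g where "g \<in> carrier G" "C = cl g" using \<open>C \<in> conj_classes G\<close> CG by blast
    then show ?thesis using ex[of g] by blast
  qed
  have "bij_betw (\<lambda>C. (p ` C, (#>) X ` C)) (conj_classes G)
          (conj_classes (G\<lparr>carrier := X\<rparr>) \<times> conj_classes (G Mod X))"
    unfolding bij_betw_def
  proof
    show "inj_on (\<lambda>C. (p ` C, (#>) X ` C)) (conj_classes G)"
    proof (rule inj_onI)
      fix C C'
      assume "C \<in> conj_classes G" "C' \<in> conj_classes G"
        and e: "(p ` C, (#>) X ` C) = (p ` C', (#>) X ` C')"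
      then obtain x y x' y' where "x \<in> X" "y \<in> Y" "C = cl (x \<otimes> y)"
        and "x' \<in> X" "y' \<in> Y" "C' = cl (x' \<otimes> y')"
        by (meson CG_ex)
      with e show "C = C'"
        using cl_cong[of x y x' y'] by (simp only: p_cl q_cl prod.inject)
    qed
    have into: "(p ` C, (#>) X ` C) \<in> clX ` X \<times> clQ ` carrier G" if "C \<in> conj_classes G" for C
    proof -
      obtain x y where "x \<in> X" "y \<in> Y" "C = cl (x \<otimes> y)"
        using CG_ex \<open>C \<in> conj_classes G\<close> by blast
      then show ?thesis using p_cl q_cl cX cY by simp
    qed
    have onto: "(clX x, clQ g) \<in> (\<lambda>C. (p ` C, (#>) X ` C)) ` conj_classes G"
      if x: "x \<in> X" and g: "g \<in> carrier G" for x g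
    proof -
      \<comment> \<open>Only the \<open>Y\<close>-factor of \<open>g\<close> is kept: replacing
        \<open>x'\<close> by the prescribed \<open>x\<close> leaves the quotient class
        unchanged.\<close>
      obtain x' y where "x' \<in> X" "y \<in> Y" "g = x' \<otimes> y" using ex[OF g] by blast
      then have "(clX x, clQ g) = (p ` cl (x \<otimes> y), (#>) X ` cl (x \<otimes> y))"
        using x p_cl q_cl clQ_Y by simp
      moreover have "cl (x \<otimes> y) \<in> conj_classes G"
        unfolding CG using x \<open>y \<in> Y\<close> cX cY by simp
      ultimately show ?thesis by (rule image_eqI)
    qed
    show "(\<lambda>C. (p ` C, (#>) X ` C)) ` conj_classes G =
        conj_classes (G\<lparr>carrier := X\<rparr>) \<times> conj_classes (G Mod X)"
      unfolding CX CQ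
    proof
      show "(\<lambda>C. (p ` C, (#>) X ` C)) ` conj_classes G \<subseteq> clX ` X \<times> clQ ` carrier G"
        using into by (rule image_subsetI)
      show "clX ` X \<times> clQ ` carrier G \<subseteq> (\<lambda>C. (p ` C, (#>) X ` C)) ` conj_classes G"
        by (clarify, rule onto)
    qed
  qed
  \<comment> \<open>An infinite set of classes has \<open>card\<close> equal to 0, a value for which
    both cardinality rules stay valid.\<close>
  from bij_betw_same_card[OF this] show ?thesis
    unfolding num_conj_classes_def card_cartesian_product .
qed

section \<open>A central subgroup acting on conjugacy classes\<close>

text \<open>A central \<open>z\<close> passes through conjugation, so translation by
  \<open>z\<close> carries the class of \<open>h\<close> to the class of
  \<open>z \<otimes> h\<close>.\<close>

lemma central_conj_classes_action:
  assumes Z: "subgroup Z G" and N: "subgroup N G" and ZN: "Z \<subseteq> N"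
    and central: "\<And>z g. \<lbrakk>z \<in> Z; g \<in> carrier G\<rbrakk> \<Longrightarrow> z \<otimes> g = g \<otimes> z"
  shows "group_action (G\<lparr>carrier := Z\<rparr>) (conj_classes_in G N)
    (\<lambda>z. \<lambda>C\<in>conj_classes_in G N. z <# C)"
proof -
  let ?E = "conj_classes_in G N"
  let ?\<phi> = "\<lambda>z. \<lambda>C\<in>?E. z <# C"
  have cZ: "z \<in> carrier G" if "z \<in> Z" for z
    using that Z subgroup.subset by blast
  have E_subset: "C \<subseteq> carrier G" if "C \<in> ?E" for C
    using that N subgroup.subset unfolding conj_classes_in_def by blast
  have translate: "z <# C \<in> ?E" if z: "z \<in> Z" and C: "C \<in> ?E" for z C
  proof -
    obtain h where h: "h \<in> carrier G" "C = (\<lambda>g. g \<otimes> h \<otimes> inv g) ` carrier G"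
      using C by (auto simp: conj_classes_in_def conj_classes_eq)
    have "z \<otimes> (g \<otimes> h \<otimes> inv g) = g \<otimes> (z \<otimes> h) \<otimes> inv g" if g: "g \<in> carrier G" for g
    proof -
      have "z \<otimes> (g \<otimes> h \<otimes> inv g) = (z \<otimes> g) \<otimes> h \<otimes> inv g"
        using g h cZ[OF z] by (simp add: m_assoc)
      also have "\<dots> = g \<otimes> (z \<otimes> h) \<otimes> inv g"
        using g h cZ[OF z] central[OF z g] by (simp add: m_assoc)
      finally show ?thesis .
    qed
    then have "z <# C = (\<lambda>g. g \<otimes> (z \<otimes> h) \<otimes> inv g) ` carrier G"
      unfolding h l_coset_def by auto
    then have "z <# C \<in> conj_classes G"
      unfolding conj_classes_eq using cZ[OF z] h by blast
    moreover have "z <# C \<subseteq> N"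
      using C z ZN subgroup.m_closed[OF N] by (auto simp: conj_classes_in_def l_coset_def)
    ultimately show ?thesis by (simp add: conj_classes_in_def)
  qed
  have inverse: "inv z <# (z <# C) = C" "z <# (inv z <# C) = C" if "z \<in> Z" "C \<in> ?E" for z C
    using that cZ E_subset by (simp_all add: lcos_m_assoc lcos_mult_one)
  \<comment> \<open>Translation by \<open>inv z\<close> is the inverse map; the restriction in
    \<open>?\<phi>\<close> gives the extensionality that \<open>Bij\<close> demands.\<close>
  have Bij: "?\<phi> z \<in> Bij ?E" if z: "z \<in> Z" for z
    unfolding Bij_def
  proof
    show "?\<phi> z \<in> {f. bij_betw f ?E ?E}"
      using z translate inverse subgroup.m_inv_closed[OF Z]
      by (auto intro!: bij_betw_byWitness[where f' = "\<lambda>C. inv z <# C"])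
  qed simp
  have mult: "?\<phi> (z \<otimes> w) = ?\<phi> z \<otimes>\<^bsub>BijGroup ?E\<^esub> ?\<phi> w" if "z \<in> Z" "w \<in> Z" for z w
    using that Bij translate cZ E_subset
    by (auto simp: BijGroup_def compose_def lcos_m_assoc intro!: restrict_ext)
  have "?\<phi> \<in> hom (G\<lparr>carrier := Z\<rparr>) (BijGroup ?E)"
    using Bij mult by (auto simp: hom_def BijGroup_def)
  then show ?thesis
    using Z by (simp add: group_action_def group_hom_def group_hom_axioms_def group_BijGroup
        subgroup_imp_group)
qed

text \<open>If \<open>z\<close> fixes the class of \<open>h = w \<otimes> y\<close>, then \<open>(z
  \<otimes> w) \<otimes> y = w \<otimes> (g \<otimes> y \<otimes> inv g)\<close> for some
  \<open>g\<close>, and uniqueness gives \<open>z \<otimes> w = w\<close>. Here \<open>g\<close>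
  ranges over all of \<open>G\<close>, so \<open>Y\<close> has to be normal in \<open>G\<close> and
  not only in \<open>N\<close>.\<close>

lemma central_conj_classes_semiregular:
  assumes Z: "subgroup Z G" and N: "subgroup N G" and ZN: "Z \<subseteq> N"
    and central: "\<And>z g. \<lbrakk>z \<in> Z; g \<in> carrier G\<rbrakk> \<Longrightarrow> z \<otimes> g = g \<otimes> z"
    and Y: "normal_subset G Y" and D: "is_set_direct_product (G\<lparr>carrier := N\<rparr>) Z Y"
  shows "semiregular_action (G\<lparr>carrier := Z\<rparr>) (conj_classes_in G N)
    (\<lambda>z. \<lambda>C\<in>conj_classes_in G N. z <# C)"
proof -
  note d = D[unfolded is_set_direct_product_subgroup_iff[OF N]]
  have cZ: "z \<in> carrier G" if "z \<in> Z" for z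
    using that Z subgroup.subset by blast
  have trivial: "z = \<one>" if z: "z \<in> Z" and C: "C \<in> conj_classes_in G N" and fix_C: "z <# C = C" for z C
  proof -
    obtain h where h: "h \<in> carrier G" "C = (\<lambda>g. g \<otimes> h \<otimes> inv g) ` carrier G" "C \<subseteq> N"
      using C by (auto simp: conj_classes_in_def conj_classes_eq)
    have "h \<in> C" using h(1) unfolding h(2) by (auto intro!: image_eqI[of _ _ \<one>])
    then obtain w y where wy: "w \<in> Z" "y \<in> Y" "h = w \<otimes> y"
      using d h(3) by blast
    have cy: "y \<in> carrier G" using Y wy by (auto simp: normal_subset_def)
    have "z \<otimes> h \<in> C" using \<open>h \<in> C\<close> fix_C by (force simp: l_coset_def)
    then obtain g where g: "g \<in> carrier G" "z \<otimes> h = g \<otimes> h \<otimes> inv g"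
      unfolding h(2) by blast
    have "g \<otimes> h \<otimes> inv g = (g \<otimes> w) \<otimes> y \<otimes> inv g"
      using g cZ wy cy by (simp add: m_assoc)
    also have "\<dots> = w \<otimes> (g \<otimes> y \<otimes> inv g)"
      using g cZ wy cy central[OF \<open>w \<in> Z\<close> g(1), symmetric] by (simp add: m_assoc)
    finally have "(z \<otimes> w) \<otimes> y = w \<otimes> (g \<otimes> y \<otimes> inv g)"
      using g cZ wy cy z by (simp add: m_assoc)
    moreover have "g \<otimes> y \<otimes> inv g \<in> Y"
      using Y g wy by (auto simp: normal_subset_def)
    ultimately have "z \<otimes> w = w"
      using d wy subgroup.m_closed[OF Z z \<open>w \<in> Z\<close>] by blast
    then show ?thesis using cZ z wy by simp
  qed
  have one: "\<one> <# C = C" if "C \<in> conj_classes_in G N" for C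
    using that N subgroup.subset by (intro lcos_mult_one) (auto simp: conj_classes_in_def)
  have "stabilizer (G\<lparr>carrier := Z\<rparr>) (\<lambda>z. \<lambda>C\<in>conj_classes_in G N. z <# C) C = {\<one>}"
    if "C \<in> conj_classes_in G N" for C
  proof
    show "{\<one>} \<subseteq> stabilizer (G\<lparr>carrier := Z\<rparr>) (\<lambda>z. \<lambda>C\<in>conj_classes_in G N. z <# C) C"
      using that one subgroup.one_closed[OF Z] by (simp add: stabilizer_def)
    show "stabilizer (G\<lparr>carrier := Z\<rparr>) (\<lambda>z. \<lambda>C\<in>conj_classes_in G N. z <# C) C \<subseteq> {\<one>}"
      using that trivial by (simp add: stabilizer_def subset_iff)
  qed
  then show ?thesis
    using central_conj_classes_action[OF Z N ZN central] by (simp add: semiregular_action_def)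
qed

section \<open>Transversals, the factorization of the generated subgroup, and central
  products\<close>

text \<open>The coset of \<open>n = z \<otimes> y\<close> contains \<open>y\<close>; any
  \<open>t\<close> of \<open>Y\<close> in it is
  \<open>\<one> \<otimes> t = (w \<otimes> z) \<otimes> y\<close> with \<open>w\<close> in
  \<open>Z\<close>, so \<open>t = y\<close> by uniqueness.\<close>

lemma set_direct_normal_transversal:
  assumes N: "subgroup N G" and Z: "subgroup Z G"
    and Y: "normal_subset G Y" and D: "is_set_direct_product (G\<lparr>carrier := N\<rparr>) Z Y"
  shows "normal_transversal G Y Z N"
proof -
  note d = D[unfolded is_set_direct_product_subgroup_iff[OF N]]
  have cZ: "z \<in> carrier G" if "z \<in> Z" for z
    using that Z subgroup.subset by blast
  have cY: "y \<in> carrier G" if "y \<in> Y" for y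
    using that Y by (auto simp: normal_subset_def)
  have YN: "Y \<subseteq> N"
    using d by (simp add: normal_subset_def)
  have "\<exists>!t. t \<in> Y \<inter> (Z #> n)" if n: "n \<in> N" for n
  proof -
    obtain z y where zy: "z \<in> Z" "y \<in> Y" "n = z \<otimes> y"
      using d n by blast
    show ?thesis
    proof (rule ex1I[of _ y])
      have "y = inv z \<otimes> n"
        using zy cY cZ by (simp add: m_assoc[symmetric])
      then show "y \<in> Y \<inter> (Z #> n)"
        using zy subgroup.m_inv_closed[OF Z] by (auto simp: r_coset_def)
      fix t assume "t \<in> Y \<inter> (Z #> n)"
      then obtain w where w: "t \<in> Y" "w \<in> Z" "t = w \<otimes> n"
        by (auto simp: r_coset_def)
      then have "\<one> \<otimes> t = (w \<otimes> z) \<otimes> y"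
        using zy cY cZ by (simp add: m_assoc)
      then show "t = y"
        using d w zy subgroup.one_closed[OF Z] subgroup.m_closed[OF Z] by blast
    qed
  qed
  then show ?thesis
    using Y YN unfolding normal_transversal_def by (auto simp: RCOSETS_def r_coset_def)
qed

lemma set_direct_commute_generate:
  assumes D: "is_set_direct_product G X Y" and X: "subgroup X G"
    and x: "x \<in> X" and n: "n \<in> generate G Y"
  shows "x \<otimes> n = n \<otimes> x"
proof (rule commute_generate[OF _ _ _ n])
  show "Y \<subseteq> carrier G"
    using D by (simp add: is_set_direct_product_iff normal_subset_def)
  show "x \<in> carrier G"
    using x X subgroup.subset by blast
  show "\<And>y. y \<in> Y \<Longrightarrow> x \<otimes> y = y \<otimes> x"
    by (rule set_direct_commute[OF D X x])
qed

text \<open>Factorizations in \<open>G\<close> of elements of the generated subgroup stay inside it,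
  because the \<open>Y\<close>-factor lies there and hence so does the other. The consequences of
  directness are derived from this smaller product.\<close>

lemma set_direct_generate:
  assumes D: "is_set_direct_product G X Y" and X: "subgroup X G"
  shows "is_set_direct_product (G\<lparr>carrier := generate G Y\<rparr>) (X \<inter> generate G Y) Y"
proof -
  define N where "N = generate G Y"
  note d = D[unfolded is_set_direct_product_iff]
  have Ycarr: "Y \<subseteq> carrier G" using d by (simp add: normal_subset_def)
  have N: "subgroup N G" unfolding N_def using Ycarr by (rule generate_is_subgroup)
  have YN: "Y \<subseteq> N" unfolding N_def by (auto intro: generate.incl)
  have cN: "n \<in> carrier G" if "n \<in> N" for n
    using that N subgroup.subset by blast
  have Xn: "normal_subset (G\<lparr>carrier := N\<rparr>) (X \<inter> N)"
    using d cN subgroup.m_closed[OF N] subgroup.m_inv_closed[OF N]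
    by (auto simp: normal_subset_def m_inv_consistent[OF N])
  have Yn: "normal_subset (G\<lparr>carrier := N\<rparr>) Y"
    using d cN YN by (auto simp: normal_subset_def m_inv_consistent[OF N])
  have "\<exists>z\<in>X \<inter> N. \<exists>y\<in>Y. n = z \<otimes> y" if n: "n \<in> N" for n
  proof -
    obtain x y where xy: "x \<in> X" "y \<in> Y" "n = x \<otimes> y" using d cN[OF n] by blast
    have "x \<in> carrier G" using xy d by (auto simp: normal_subset_def)
    then have "x = n \<otimes> inv y" using xy Ycarr by (auto simp: m_assoc)
    then have "x \<in> N"
      using n xy YN subgroup.m_closed[OF N] subgroup.m_inv_closed[OF N] by blast
    with xy show ?thesis by blast
  qed
  then have "is_set_direct_product (G\<lparr>carrier := N\<rparr>) (X \<inter> N) Y"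
    unfolding is_set_direct_product_subgroup_iff[OF N] using d Xn Yn by blast
  then show ?thesis by (simp add: N_def)
qed

text \<open>As a member of \<open>M\<close>, \<open>z\<close> commutes with the
  \<open>N\<close>-factor of \<open>g\<close>; as a member of \<open>N\<close>, with the
  \<open>M\<close>-factor.\<close>

lemma central_product_central:
  assumes C: "is_central_product G M Z N" and z: "z \<in> Z" and g: "g \<in> carrier G"
  shows "z \<otimes> g = g \<otimes> z"
proof -
  note c = C[unfolded is_central_product_def]
  obtain m n where mn: "m \<in> M" "n \<in> N" "g = m \<otimes> n"
    using c g by (auto simp: set_mult_def)
  have z': "z \<in> M" "z \<in> N" using c z by auto
  have "z \<in> carrier G" "m \<in> carrier G" "n \<in> carrier G"
    using c z' mn subgroup.subset by blast+
  moreover have "m \<otimes> z = z \<otimes> m" "z \<otimes> n = n \<otimes> z"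
    using c mn z' by blast+
  ultimately show ?thesis unfolding mn(3) by (metis m_assoc)
qed

end

section \<open>The equivalence of the two conditions and their consequences\<close>

theorem theorem1p7:
  fixes G (structure) and X Y N Z :: "'a set" and Yn :: "'a \<Rightarrow> 'a set"
  assumes "group G"
    and "normal_subset G X"
    and "normal_subset G Y"
    and "subgroup X G"
    and N_def: "N = generate G Y"
    and Z_def: "Z = X \<inter> N"
    and Yn_def: "\<And>n. n \<in> N \<Longrightarrow> Yn n = (inv n <# Y) \<inter> Z"
  shows "(is_set_direct_product G X Y \<longleftrightarrow>
            is_central_product G X Z N \<and> (\<forall>n\<in>N. card (Yn n) = 1)) \<and>
         (is_set_direct_product G X Y \<or>
            (is_central_product G X Z N \<and> (\<forall>n\<in>N. card (Yn n) = 1)) \<longrightarrow>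
            normal_transversal G Y Z N \<and>
            semiregular_action (G\<lparr>carrier := Z\<rparr>) (conj_classes_in G N)
              (\<lambda>z. \<lambda>C\<in>conj_classes_in G N. z <# C) \<and>
            (finite N \<longrightarrow>
              num_conj_classes (G\<lparr>carrier := N\<rparr>) =
                num_conj_classes (G\<lparr>carrier := Z\<rparr>) *
                num_conj_classes (G\<lparr>carrier := N\<rparr> Mod Z)))"
proof -
  interpret group G by fact
  have X: "subgroup X G" by fact
  have Ycarr: "Y \<subseteq> carrier G" using assms(3) by (simp add: normal_subset_def)
  have N: "subgroup N G" unfolding N_def using Ycarr by (rule generate_is_subgroup)
  have YN: "Y \<subseteq> N" unfolding N_def by (auto intro: generate.incl)
  have cX: "x \<in> carrier G" if "x \<in> X" for x using that X subgroup.subset by blast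
  have cN: "n \<in> carrier G" if "n \<in> N" for n using that N subgroup.subset by blast
  have Z: "subgroup Z G" unfolding Z_def using X N by (rule subgroups_Inter_pair)
  \<comment> \<open>\<open>Yn n\<close> consists of the elements of \<open>Z\<close> that multiply
    \<open>n\<close> into \<open>Y\<close>; both directions use it in this form.\<close>
  have Yn_iff: "z \<in> Yn n \<longleftrightarrow> z \<in> Z \<and> n \<otimes> z \<in> Y" if n: "n \<in> N" for n z
  proof -
    have "z \<in> inv n <# Y \<longleftrightarrow> n \<otimes> z \<in> Y" if z: "z \<in> Z"
    proof
      have "z \<in> carrier G" using z cX by (simp add: Z_def)
      then show "n \<otimes> z \<in> Y \<Longrightarrow> z \<in> inv n <# Y"
        using cN[OF n] by (auto simp: l_coset_def m_assoc[symmetric] intro!: bexI[of _ "n \<otimes> z"])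
      show "z \<in> inv n <# Y \<Longrightarrow> n \<otimes> z \<in> Y"
        using cN[OF n] Ycarr by (auto simp: l_coset_def m_assoc[symmetric] subset_iff)
    qed
    then show ?thesis using Yn_def[OF n] by blast
  qed
  have central_if: "is_central_product G X Z N" if D: "is_set_direct_product G X Y"
  proof -
    have "carrier G = X <#> N"
    proof
      show "carrier G \<subseteq> X <#> N"
        using D YN by (auto simp: is_set_direct_product_def set_mult_def)
      show "X <#> N \<subseteq> carrier G"
        using cX cN by (auto simp: set_mult_def)
    qed
    then show ?thesis
      using X N Z_def set_direct_commute_generate[OF D X, folded N_def]
      unfolding is_central_product_def by blast
  qed
  have card_if: "card (Yn n) = 1" if D: "is_set_direct_product G X Y" and n: "n \<in> N" for n
  proof -
    note d = set_direct_generate[OF D X, folded N_def, folded Z_def]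
    note d = d[unfolded is_set_direct_product_subgroup_iff[OF N]]
    note central = central_product_central[OF central_if[OF D]]
    obtain z y where zy: "z \<in> Z" "y \<in> Y" "n = z \<otimes> y" using d n by blast
    have cz: "z \<in> carrier G" and cy: "y \<in> carrier G" using zy cX Ycarr by (auto simp: Z_def)
    have "w \<in> Yn n \<longleftrightarrow> w = inv z" for w
    proof
      assume "w = inv z"
      moreover have "n \<otimes> inv z = y"
        using central[OF \<open>z \<in> Z\<close> cy] zy cz cy by (simp add: m_assoc)
      ultimately show "w \<in> Yn n"
        unfolding Yn_iff[OF n] using zy(1,2) subgroup.m_inv_closed[OF Z] by simp
    next
      assume "w \<in> Yn n"
      then have w: "w \<in> Z" "n \<otimes> w \<in> Y" by (simp_all add: Yn_iff[OF n])
      have cw: "w \<in> carrier G" using w cX by (simp add: Z_def)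
      \<comment> \<open>Centrality moves \<open>w\<close> to the front, so the element
        \<open>n \<otimes> w\<close> of \<open>Y\<close> has two factorizations, with
        \<open>Z\<close>-parts \<open>\<one>\<close> and \<open>w \<otimes> z\<close>.\<close>
      have "\<one> \<otimes> (n \<otimes> w) = (w \<otimes> z) \<otimes> y"
        using central[OF \<open>w \<in> Z\<close>, of n] cw cz cy zy by (simp add: m_assoc)
      then have "\<one> = w \<otimes> z"
        using d w zy subgroup.one_closed[OF Z] subgroup.m_closed[OF Z] by blast
      then show "w = inv z"
        using cw cz inv_equality by metis
    qed
    then have "Yn n = {inv z}" by blast
    then show ?thesis by simp
  qed
  have direct_if: "is_set_direct_product G X Y"
    if C: "is_central_product G X Z N" and card1: "\<forall>n\<in>N. card (Yn n) = 1"
    unfolding is_set_direct_product_iff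
  proof (intro conjI ballI impI)
    fix g assume "g \<in> carrier G"
    then obtain x n where xn: "x \<in> X" "n \<in> N" "g = x \<otimes> n"
      using C by (auto simp: is_central_product_def set_mult_def)
    \<comment> \<open>Existence of factorizations uses that \<open>Yn n\<close> is non-empty; that
      it has at most one element serves for uniqueness below.\<close>
    then obtain z where "z \<in> Yn n"
      using card1 by (metis card_1_singletonE One_nat_def insertI1)
    then have z: "z \<in> Z" "n \<otimes> z \<in> Y" by (simp_all add: Yn_iff[OF \<open>n \<in> N\<close>])
    have c: "x \<in> carrier G" "n \<in> carrier G" "z \<in> carrier G"
      using xn z cX cN by (auto simp: Z_def)
    have "(x \<otimes> inv z) \<otimes> (n \<otimes> z) = (x \<otimes> inv z) \<otimes> (z \<otimes> n)"
      using central_product_central[OF C, of z n] z c by simp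
    also have "\<dots> = g"
      using c xn by (metis inv_closed inv_solve_left m_assoc m_closed)
    finally have "g = (x \<otimes> inv z) \<otimes> (n \<otimes> z)" ..
    moreover have "x \<otimes> inv z \<in> X"
      using xn z subgroup.m_closed[OF X] subgroup.m_inv_closed[OF X] by (simp add: Z_def)
    ultimately show "\<exists>x\<in>X. \<exists>y\<in>Y. g = x \<otimes> y" using z by blast
  next
    fix x x' y y'
    assume xy: "x \<in> X" "x' \<in> X" "y \<in> Y" "y' \<in> Y" "x \<otimes> y = x' \<otimes> y'"
    \<comment> \<open>The discrepancy of the two \<open>X\<close>-factors. It also equals
      \<open>y' \<otimes> inv y\<close>, which puts it into \<open>X \<inter> N\<close>.\<close>
    define z where "z = inv x' \<otimes> x"
    have c: "x \<in> carrier G" "x' \<in> carrier G" "y \<in> carrier G" "y' \<in> carrier G"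
      using xy cX Ycarr by auto
    have "inv x' \<otimes> (x \<otimes> y) = y'"
      using xy(5) c by (simp add: m_assoc[symmetric])
    then have zy: "z \<otimes> y = y'"
      using c by (simp add: z_def m_assoc)
    then have "z = y' \<otimes> inv y"
      using c by (auto simp: z_def m_assoc)
    then have zZ: "z \<in> Z"
      using xy YN X N unfolding Z_def z_def
      by (metis IntI subgroup.m_closed subgroup.m_inv_closed subsetD z_def)
    have "y \<in> N" using xy YN by blast
    have "z \<in> Yn y"
      using zy central_product_central[OF C zZ, of y] c xy zZ by (simp add: Yn_iff[OF \<open>y \<in> N\<close>])
    moreover have "\<one> \<in> Yn y"
      using c xy subgroup.one_closed[OF Z] by (simp add: Yn_iff[OF \<open>y \<in> N\<close>])
    \<comment> \<open>Both \<open>z\<close> and \<open>\<one>\<close> carry \<open>y\<close> into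
      \<open>Y\<close>, and \<open>Yn y\<close> is a singleton.\<close>
    ultimately have "z = \<one>"
      using card1 \<open>y \<in> N\<close> by (metis card_1_singletonE One_nat_def singletonD)
    then show "x = x'" "y = y'"
      using zy c by (auto simp: z_def) (metis inv_closed inv_equality inv_inv)
  qed (rule assms)+
  \<comment> \<open>It is enough to start from the set-direct product, since
    \<open>direct_if\<close> reduces the other condition to it.\<close>
  have cons: "normal_transversal G Y Z N \<and>
      semiregular_action (G\<lparr>carrier := Z\<rparr>) (conj_classes_in G N)
        (\<lambda>z. \<lambda>C\<in>conj_classes_in G N. z <# C) \<and>
      num_conj_classes (G\<lparr>carrier := N\<rparr>) =
        num_conj_classes (G\<lparr>carrier := Z\<rparr>) * num_conj_classes (G\<lparr>carrier := N\<rparr> Mod Z)"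
    if D: "is_set_direct_product G X Y"
  proof -
    have DN: "is_set_direct_product (G\<lparr>carrier := N\<rparr>) Z Y"
      using set_direct_generate[OF D X] by (simp add: Z_def N_def)
    have ZN: "Z \<subseteq> N" by (simp add: Z_def)
    \<comment> \<open>The class count is applied to the factorization of \<open>N\<close>, with
      \<open>Z\<close> in the role of the subgroup factor.\<close>
    interpret H: group "G\<lparr>carrier := N\<rparr>" using N by (rule subgroup_imp_group)
    have "subgroup Z (G\<lparr>carrier := N\<rparr>)" using Z N ZN by (rule subgroup_incl)
    from H.set_direct_num_conj_classes[OF DN this]
    show ?thesis
      using set_direct_normal_transversal[OF N Z assms(3) DN]
        central_conj_classes_semiregular[OF Z N ZN central_product_central[OF central_if[OF D]]
          assms(3) DN]
      by simp
  qed
  show ?thesis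
    using central_if card_if direct_if cons by blast
qed

end
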